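(* Let $\mu$ and $\nu$ be complex Borel measures on $[0,\infty)$ such that \[ \int_{[0,\infty)} e^{-nt}\, d\mu(t)=\int_{[0,\infty)} e^{-nt}\, d\nu(t)\qquad\text{for all } n=0,1,2,\dots \] Then $\mu=\nu$. *)

theory Defs
  imports "HOL-Analysis.Analysis"
begin

(* Complex measures are complex-valued set functions on sets M; only the measurable space
   underlying M matters, the measure carried by M plays no role.  Values outside sets M are
   irrelevant.  The series converges for every enumeration of the disjoint family, hence
   absolutely. *)
definition complex_measure :: "'a measure \<Rightarrow> ('a set \<Rightarrow> complex) \<Rightarrow> bool" where
  "complex_measure M \<mu> \<longleftrightarrow>
     \<mu> {} = 0 \<and>
     (\<forall>A. range A \<subseteq> sets M \<longrightarrow> disjoint_family A \<longrightarrow>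
        (\<lambda>n::nat. \<mu> (A n)) sums \<mu> (\<Union>n. A n))"

(* The positive part in the Jordan decomposition of a signed measure s.  As s {} = 0,
   truncating negative values to 0 by ennreal does not change the supremum. *)
definition upper_variation :: "'a measure \<Rightarrow> ('a set \<Rightarrow> real) \<Rightarrow> 'a measure" where
  "upper_variation M s =
     measure_of (space M) (sets M) (\<lambda>A. SUP B\<in>{B \<in> sets M. B \<subseteq> A}. ennreal (s B))"

definition lower_variation :: "'a measure \<Rightarrow> ('a set \<Rightarrow> real) \<Rightarrow> 'a measure" where
  "lower_variation M s = upper_variation M (\<lambda>A. - s A)"

definition signed_integral ::
    "'a measure \<Rightarrow> ('a set \<Rightarrow> real) \<Rightarrow> ('a \<Rightarrow> complex) \<Rightarrow> complex" where
  "signed_integral M s f =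
     integral\<^sup>L (upper_variation M s) f - integral\<^sup>L (lower_variation M s) f"

definition complex_measure_integral ::
    "'a measure \<Rightarrow> ('a set \<Rightarrow> complex) \<Rightarrow> ('a \<Rightarrow> complex) \<Rightarrow> complex" where
  "complex_measure_integral M \<mu> f =
     signed_integral M (\<lambda>A. Re (\<mu> A)) f + \<i> * signed_integral M (\<lambda>A. Im (\<mu> A)) f"

definition half_line_borel :: "real measure" where
  "half_line_borel = restrict_space borel {0..}"

lemma space_upper_variation [simp]: "space (upper_variation M s) = space M"
  and sets_upper_variation [simp, measurable_cong]: "sets (upper_variation M s) = sets M"
  by (simp_all add: upper_variation_def)

(* measure_of yields the null measure unless its argument is a measure; for a signed measure
   s the supremum is one. *)
lemma emeasure_upper_variation:
  fixes s :: "'a set \<Rightarrow> real"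
  assumes s0: "s {} = 0"
    and ca: "\<And>A. range A \<subseteq> sets M \<Longrightarrow> disjoint_family A \<Longrightarrow>
               (\<lambda>n::nat. s (A n)) sums s (\<Union>n. A n)"
    and E: "E \<in> sets M"
  shows "emeasure (upper_variation M s) E = (SUP B\<in>{B \<in> sets M. B \<subseteq> E}. ennreal (s B))"
proof -
  define P where "P A = (SUP B\<in>{B \<in> sets M. B \<subseteq> A}. ennreal (s B))" for A
  have le_P: "ennreal (s B) \<le> P A" if "B \<in> sets M" "B \<subseteq> A" for A B
    unfolding P_def using that by (intro SUP_upper) auto
  have P_empty: "P {} = 0"
    unfolding P_def using s0 by (auto simp: SUP_eq_iff intro!: antisym SUP_least)
  have add: "s (A \<union> B) = s A + s B" if "A \<in> sets M" "B \<in> sets M" "A \<inter> B = {}" for A B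
  proof -
    have "(\<lambda>n. s (binaryset A B n)) sums s (\<Union>n. binaryset A B n)"
      using that by (intro ca) (auto simp: range_binaryset_eq disjoint_family_on_def binaryset_def)
    moreover have "(\<lambda>n. s (binaryset A B n)) sums (s A + s B)"
      using s0 by (intro binaryset_sums)
    ultimately show ?thesis by (simp add: UN_binaryset_eq sums_unique2)
  qed
  have super: "P A + P C \<le> P (A \<union> C)" if AC: "A \<inter> C = {}" for A C
  proof -
    have *: "ennreal (s B) + ennreal (s D) \<le> P (A \<union> C)"
      if "B \<in> sets M" "B \<subseteq> A" "D \<in> sets M" "D \<subseteq> C" for B D
    proof (cases "0 \<le> s B \<and> 0 \<le> s D")
      case True
      then have "ennreal (s B) + ennreal (s D) = ennreal (s (B \<union> D))"
        using that AC by (subst add) (auto simp: ennreal_plus)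
      then show ?thesis using that by (auto intro!: le_P)
    next
      case False
      then have "ennreal (s B) = 0 \<or> ennreal (s D) = 0" by (auto simp: ennreal_eq_0_iff)
      then show ?thesis using that by (auto intro!: le_P)
    qed
    have **: "ennreal (s B) + P C \<le> P (A \<union> C)" if B: "B \<in> sets M" "B \<subseteq> A" for B
    proof -
      have "ennreal (s B) + P C = (SUP D\<in>{D \<in> sets M. D \<subseteq> C}. ennreal (s B) + ennreal (s D))"
        unfolding P_def by (rule ennreal_SUP_add_right) auto
      also have "\<dots> \<le> P (A \<union> C)" using * B by (intro SUP_least) auto
      finally show ?thesis .
    qed
    have "P A + P C = P C + P A" by (simp add: add.commute)
    also have "\<dots> = (SUP B\<in>{B \<in> sets M. B \<subseteq> A}. P C + ennreal (s B))"
      unfolding P_def[of A] by (rule ennreal_SUP_add_right) auto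
    also have "\<dots> \<le> P (A \<union> C)" using ** by (intro SUP_least) (auto simp: add.commute)
    finally show ?thesis .
  qed
  have P_mono: "P A \<le> P B" if "A \<subseteq> B" for A B
    unfolding P_def using that by (intro SUP_subset_mono) auto
  have "countably_additive (sets M) P"
  proof (rule countably_additiveI)
    fix A :: "nat \<Rightarrow> 'a set"
    assume A: "range A \<subseteq> sets M" and dA: "disjoint_family A"
    have fin: "(\<Sum>i<n. P (A i)) \<le> P (\<Union>i<n. A i)" for n
    proof (induction n)
      case (Suc n)
      have "A i \<inter> A n = {}" if "i < n" for i
        using dA that by (simp add: disjoint_family_on_def)
      then have disj: "(\<Union>i<n. A i) \<inter> A n = {}" by blast
      have "(\<Sum>i<Suc n. P (A i)) \<le> P (\<Union>i<n. A i) + P (A n)" using Suc by (simp add: add_mono)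
      also have "\<dots> \<le> P ((\<Union>i<n. A i) \<union> A n)"
        using disj by (rule super)
      also have "(\<Union>i<n. A i) \<union> A n = (\<Union>i<Suc n. A i)" by (auto simp: lessThan_Suc)
      finally show ?case .
    qed (simp add: P_empty)
    have "(\<Sum>i. P (A i)) \<le> P (\<Union>i. A i)"
      by (intro suminf_le_const summableI order_trans[OF fin] P_mono) auto
    moreover have "P (\<Union>i. A i) \<le> (\<Sum>i. P (A i))"
      unfolding P_def[of "\<Union>i. A i"]
    proof (rule SUP_least)
      fix B assume "B \<in> {B \<in> sets M. B \<subseteq> (\<Union>i. A i)}"
      then have B: "B \<in> sets M" "(\<Union>i. B \<inter> A i) = B" by auto
      have "(\<lambda>n. s (B \<inter> A n)) sums s (\<Union>n. B \<inter> A n)"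
        using A B(1) dA by (intro ca) (auto simp: disjoint_family_on_def)
      then have "(\<lambda>n. \<Sum>i<n. s (B \<inter> A i)) \<longlonglongrightarrow> s B"
        by (simp only: B(2) sums_def)
      then have "(\<lambda>n. ennreal (\<Sum>i<n. s (B \<inter> A i))) \<longlonglongrightarrow> ennreal (s B)"
        by (rule tendsto_ennrealI)
      moreover have "ennreal (\<Sum>i<n. s (B \<inter> A i)) \<le> (\<Sum>i. P (A i))" for n
      proof -
        have "ennreal (\<Sum>i<n. s (B \<inter> A i)) \<le> ennreal (\<Sum>i<n. max 0 (s (B \<inter> A i)))"
          by (intro ennreal_leI sum_mono) auto
        also have "\<dots> = (\<Sum>i<n. ennreal (max 0 (s (B \<inter> A i))))"
          by (rule sum_ennreal[symmetric]) simp
        also have "\<dots> = (\<Sum>i<n. ennreal (s (B \<inter> A i)))"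
          by (intro sum.cong refl) (simp add: max_def ennreal_neg)
        also have "\<dots> \<le> (\<Sum>i<n. P (A i))" using A B(1) by (intro sum_mono le_P) auto
        also have "\<dots> \<le> (\<Sum>i. P (A i))" by (intro sum_le_suminf) auto
        finally show ?thesis .
      qed
      ultimately show "ennreal (s B) \<le> (\<Sum>i. P (A i))"
        by (intro LIMSEQ_le_const2) auto
    qed
    ultimately show "(\<Sum>i. P (A i)) = P (\<Union>i. A i)" by (rule antisym)
  qed
  moreover have "positive (sets M) P" using P_empty by (simp add: positive_def)
  ultimately have "emeasure (measure_of (space M) (sets M) (\<lambda>A. P A)) E = P E"
    using E by (intro emeasure_measure_of_sigma) (auto intro: sets.sigma_algebra_axioms)
  then show ?thesis by (simp add: upper_variation_def P_def)
qed

end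

(* Integration against a complex measure is linear and continuous under bounded pointwise
   convergence, once the real and imaginary parts are known to have finite variation. Agreement on
   the functions exp (- n t) therefore passes to polynomials in exp (- t), by the Weierstrass theorem
   to continuous functions of exp (- t), and by monotone approximation to indicators of the intervals
   [0, x). These form an intersection-stable generator of the Borel sets, and n = 0 gives the total
   mass, so a Dynkin system argument finishes the proof. *)

theory Submission
  imports Defs
begin

section \<open>Signed measures: real and imaginary parts, additivity\<close>

text \<open>Packages the two hypotheses of \<open>emeasure_upper_variation\<close>, so that real
  parts, imaginary parts and their negatives can all be treated by one theory.\<close>

definition signed_measure :: "'a measure \<Rightarrow> ('a set \<Rightarrow> real) \<Rightarrow> bool" where
  "signed_measure M s \<longleftrightarrow>
     s {} = 0 \<and>
     (\<forall>A. range A \<subseteq> sets M \<longrightarrow> disjoint_family A \<longrightarrow>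
        (\<lambda>n::nat. s (A n)) sums s (\<Union>n. A n))"

lemma signed_measure_uminus: "signed_measure M s \<Longrightarrow> signed_measure M (\<lambda>A. - s A)"
  unfolding signed_measure_def by (auto intro: sums_minus)

lemma signed_measure_Re: "complex_measure M \<mu> \<Longrightarrow> signed_measure M (\<lambda>A. Re (\<mu> A))"
  unfolding signed_measure_def complex_measure_def by (auto intro: sums_Re)

lemma signed_measure_Im: "complex_measure M \<mu> \<Longrightarrow> signed_measure M (\<lambda>A. Im (\<mu> A))"
  unfolding signed_measure_def complex_measure_def by (auto intro: sums_Im)

lemma complex_measure_sums:
  assumes "complex_measure M \<mu>" "range A \<subseteq> sets M" "disjoint_family A"
  shows "(\<lambda>n::nat. \<mu> (A n)) sums \<mu> (\<Union>n. A n)"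
  using assms by (simp add: complex_measure_def)

lemma emeasure_upper_variation_signed:
  assumes "signed_measure M s" "E \<in> sets M"
  shows "emeasure (upper_variation M s) E = (SUP B\<in>{B \<in> sets M. B \<subseteq> E}. ennreal (s B))"
  using assms by (intro emeasure_upper_variation) (auto simp: signed_measure_def)

lemma signed_measure_Un:
  assumes s: "signed_measure M s" and "A \<in> sets M" "B \<in> sets M" "A \<inter> B = {}"
  shows "s (A \<union> B) = s A + s B"
proof -
  have "(\<lambda>n. s (binaryset A B n)) sums s (\<Union>n. binaryset A B n)"
  proof -
    have "range (binaryset A B) \<subseteq> sets M" "disjoint_family (binaryset A B)"
      using assms by (auto simp: range_binaryset_eq disjoint_family_on_def binaryset_def)
    then show ?thesis using s by (simp add: signed_measure_def)
  qed
  moreover have "(\<lambda>n. s (binaryset A B n)) sums (s A + s B)"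
    using s by (intro binaryset_sums) (simp add: signed_measure_def)
  ultimately show ?thesis by (simp add: UN_binaryset_eq sums_unique2)
qed

lemma signed_measure_Diff:
  assumes "signed_measure M s" "A \<in> sets M" "B \<in> sets M" "B \<subseteq> A"
  shows "s (A - B) = s A - s B"
proof -
  have "A = (A - B) \<union> B" using assms by auto
  then have "s A = s ((A - B) \<union> B)" by simp
  also have "\<dots> = s (A - B) + s B"
    using assms by (intro signed_measure_Un) auto
  finally show ?thesis by simp
qed

lemma complex_measure_Diff:
  assumes "complex_measure M \<mu>" "A \<in> sets M" "B \<in> sets M" "B \<subseteq> A"
  shows "\<mu> (A - B) = \<mu> A - \<mu> B"
  using signed_measure_Diff[OF signed_measure_Re[OF assms(1)] assms(2-4)]
    signed_measure_Diff[OF signed_measure_Im[OF assms(1)] assms(2-4)]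
  by (simp add: complex_eq_iff)

section \<open>Finiteness of the variations and the Jordan decomposition\<close>

text \<open>If the positive variation were infinite, one could repeatedly split off a piece of charge at
  least 1 in absolute value, keeping infinite variation in the rest. These disjoint pieces contradict
  the convergence required by countable additivity.\<close>

lemma finite_upper_variation:
  assumes s: "signed_measure M s"
  shows "finite_measure (upper_variation M s)"
proof (rule finite_measureI, rule notI)
  let ?P = "emeasure (upper_variation M s)"
  assume "?P (space (upper_variation M s)) = \<infinity>"
  then have top: "?P (space M) = top" by simp
  have split: "\<exists>B. (B \<in> sets M \<and> ?P B = top) \<and> B \<subseteq> A \<and> 1 \<le> \<bar>s (A - B)\<bar>"
    if A: "A \<in> sets M \<and> ?P A = top" for A
  proof -
    \<comment> \<open>The threshold makes both halves usable: \<open>s B\<close> exceeds 1, and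
      \<open>s (A - B) = s A - s B\<close> lies below -1. So whichever of \<open>B\<close> and
      \<open>A - B\<close> keeps infinite variation, the discarded one has charge at least 1 in
      absolute value.\<close>
    have "ennreal (\<bar>s A\<bar> + 1) < (SUP B\<in>{B \<in> sets M. B \<subseteq> A}. ennreal (s B))"
      using A emeasure_upper_variation_signed[OF s, of A] by (simp add: less_top[symmetric])
    then obtain B where B: "B \<in> sets M" "B \<subseteq> A" "ennreal (\<bar>s A\<bar> + 1) < ennreal (s B)"
      by (auto simp: less_SUP_iff)
    then have big: "\<bar>s A\<bar> + 1 < s B"
      by (metis abs_ge_zero add_nonneg_nonneg ennreal_less_iff zero_le_one)
    have diff: "s (A - B) = s A - s B" using s A B by (intro signed_measure_Diff) auto
    have "?P B + ?P (A - B) = ?P (B \<union> (A - B))"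
      using A B by (intro plus_emeasure) auto
    also have "B \<union> (A - B) = A" using B by auto
    finally have "?P B + ?P (A - B) = ?P A" .
    then consider "?P B = top" | "?P (A - B) = top"
      using A by (auto simp: ennreal_add_eq_top)
    then show ?thesis
    proof cases
      case 1
      then show ?thesis using B diff big by (intro exI[of _ B]) auto
    next
      case 2
      moreover have "A - (A - B) = B" using B by auto
      ultimately show ?thesis using A B big by (intro exI[of _ "A - B"]) auto
    qed
  qed
  have "\<exists>A. \<forall>n. (A n \<in> sets M \<and> ?P (A n) = top) \<and>
      (A (Suc n) \<subseteq> A n \<and> 1 \<le> \<bar>s (A n - A (Suc n))\<bar>)"
  proof (rule dependent_nat_choice)
    show "\<exists>A. A \<in> sets M \<and> ?P A = top" using top by blast
  qed (rule split)
  then obtain A where A: "\<And>n. A n \<in> sets M \<and> ?P (A n) = top"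
      "\<And>n. A (Suc n) \<subseteq> A n \<and> 1 \<le> \<bar>s (A n - A (Suc n))\<bar>"
    by blast
  have anti: "A n \<subseteq> A m" if "m \<le> n" for m n
    using that A(2) by (induction rule: dec_induct) auto
  define D where "D n = A n - A (Suc n)" for n
  have "disjoint_family D"
    unfolding disjoint_family_on_def
  proof (intro ballI impI)
    \<comment> \<open>If \<open>m < n\<close>, then \<open>D n\<close> lies in \<open>A n\<close>,
      hence in \<open>A (Suc m)\<close>, which \<open>D m\<close> avoids; the other case is
      symmetric.\<close>
    fix m n :: nat assume "m \<noteq> n"
    then show "D m \<inter> D n = {}"
      using anti[of "Suc m" n] anti[of "Suc n" m] by (cases m n rule: linorder_cases) (auto simp: D_def)
  qed
  moreover have "range D \<subseteq> sets M" using A by (auto simp: D_def)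
  ultimately have "(\<lambda>n. s (D n)) sums s (\<Union>n. D n)"
    using s by (simp add: signed_measure_def)
  then have "(\<lambda>n. s (D n)) \<longlonglongrightarrow> 0"
    by (intro summable_LIMSEQ_zero) (auto simp: summable_def)
  then obtain n where "norm (s (D n)) < 1"
    using LIMSEQ_D[of "\<lambda>n. s (D n)" 0 1] by auto
  then show False using A(2)[of n] by (simp add: D_def)
qed

lemma finite_lower_variation:
  "signed_measure M s \<Longrightarrow> finite_measure (lower_variation M s)"
  unfolding lower_variation_def by (intro finite_upper_variation signed_measure_uminus)

lemma sets_lower_variation [simp, measurable_cong]: "sets (lower_variation M s) = sets M"
  and space_lower_variation [simp]: "space (lower_variation M s) = space M"
  by (simp_all add: lower_variation_def)

lemma measure_upper_variation_ge:
  assumes s: "signed_measure M s" and "B \<in> sets M" "B \<subseteq> E" "E \<in> sets M"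
  shows "s B \<le> measure (upper_variation M s) E"
proof -
  interpret finite_measure "upper_variation M s" using s by (rule finite_upper_variation)
  have "ennreal (s B) \<le> emeasure (upper_variation M s) E"
    using assms by (auto simp: emeasure_upper_variation_signed intro!: SUP_upper)
  then show ?thesis by (simp add: emeasure_eq_measure)
qed

text \<open>For measurable \<open>B\<close> inside \<open>E\<close>,
  \<open>s B = s E - s (E - B)\<close>, and \<open>- s (E - B)\<close> is one of the values whose
  supremum is the lower variation of \<open>E\<close>. Taking the supremum over \<open>B\<close>
  gives the bound.\<close>

lemma measure_upper_variation_le:
  assumes s: "signed_measure M s" and E: "E \<in> sets M"
  shows "measure (upper_variation M s) E \<le> s E + measure (lower_variation M s) E"
proof -
  interpret finite_measure "upper_variation M s" using s by (rule finite_upper_variation)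
  let ?b = "s E + measure (lower_variation M s) E"
  have le: "s B \<le> ?b" if B: "B \<in> sets M" "B \<subseteq> E" for B
  proof -
    have "- s (E - B) \<le> measure (lower_variation M s) E"
      unfolding lower_variation_def
      using measure_upper_variation_ge[OF signed_measure_uminus[OF s], of "E - B" E] B E by auto
    then show ?thesis using signed_measure_Diff[OF s E B] by simp
  qed
  \<comment> \<open>Nonnegativity of the bound ensures that \<open>ennreal\<close> does not truncate
    it, so the inequality can be read back in the reals.\<close>
  from le[of "{}"] s have "0 \<le> ?b" by (simp add: signed_measure_def)
  moreover have "emeasure (upper_variation M s) E \<le> ennreal ?b"
    using s E le by (auto simp: emeasure_upper_variation_signed intro!: SUP_least ennreal_leI)
  ultimately show ?thesis by (simp add: emeasure_eq_measure)
qed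

text \<open>Replacing \<open>s\<close> by its negative swaps the two variations, so the preceding
  inequality, used for both, gives the two directions of the equality.\<close>

theorem Jordan_decomposition:
  assumes s: "signed_measure M s" and E: "E \<in> sets M"
  shows "s E = measure (upper_variation M s) E - measure (lower_variation M s) E"
  using measure_upper_variation_le[OF s E] measure_upper_variation_le[OF signed_measure_uminus[OF s] E]
  by (simp add: lower_variation_def)

section \<open>Integration against signed measures\<close>

lemma integrable_bounded_variation:
  fixes f :: "'a \<Rightarrow> complex"
  assumes s: "signed_measure M s" and f: "f \<in> borel_measurable M" "\<And>x. x \<in> space M \<Longrightarrow> norm (f x) \<le> K"
  shows "integrable (upper_variation M s) f" "integrable (lower_variation M s) f"
  using f by (auto intro!: finite_measure.integrable_const_bound[where B=K] AE_I2
      finite_upper_variation[OF s] finite_lower_variation[OF s])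

text \<open>This is where the Jordan decomposition enters: it turns the difference of the two
  variations back into the charge of \<open>E\<close>, so equal integrals of indicators yield equal
  set values.\<close>

lemma signed_integral_indicator:
  assumes s: "signed_measure M s" and E: "E \<in> sets M"
  shows "signed_integral M s (indicator E) = of_real (s E)"
proof -
  have "E \<inter> space M = E" using sets.sets_into_space[OF E] by auto
  have "integral\<^sup>L N (indicator E) = complex_of_real (measure N E)" if "space N = space M" for N
    using that integral_complex_of_real[of N "indicator E"] \<open>E \<inter> space M = E\<close>
    by (simp add: of_real_indicator)
  then show ?thesis
    by (simp add: signed_integral_def Jordan_decomposition[OF s E])
qed

lemma signed_integral_sum:
  fixes f :: "'i \<Rightarrow> 'a \<Rightarrow> complex"
  assumes s: "signed_measure M s" and "\<And>i. i \<in> I \<Longrightarrow> f i \<in> borel_measurable M"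
    and "\<And>i x. i \<in> I \<Longrightarrow> x \<in> space M \<Longrightarrow> norm (f i x) \<le> K"
  shows "signed_integral M s (\<lambda>x. \<Sum>i\<in>I. c i * f i x) = (\<Sum>i\<in>I. c i * signed_integral M s (f i))"
proof -
  have int: "integrable (upper_variation M s) (f i)" "integrable (lower_variation M s) (f i)"
    if "i \<in> I" for i
    using integrable_bounded_variation[OF s] assms(2,3) that by blast+
  have "integral\<^sup>L N (\<lambda>x. \<Sum>i\<in>I. c i * f i x) = (\<Sum>i\<in>I. c i * integral\<^sup>L N (f i))"
    if "\<And>i. i \<in> I \<Longrightarrow> integrable N (f i)" for N
    using that by (subst Bochner_Integration.integral_sum) auto
  then show ?thesis
    by (simp add: int signed_integral_def sum_subtractf right_diff_distrib)
qed

text \<open>Both variations are finite, so the constant \<open>K\<close> is an integrable majorant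
  and dominated convergence applies to each separately.\<close>

lemma signed_integral_bounded_convergence:
  fixes f :: "'a \<Rightarrow> complex"
  assumes s: "signed_measure M s" and u: "\<And>n. u n \<in> borel_measurable M"
    and f: "f \<in> borel_measurable M"
    and K: "\<And>n x. x \<in> space M \<Longrightarrow> norm (u n x) \<le> K"
    and lim: "\<And>x. x \<in> space M \<Longrightarrow> (\<lambda>n. u n x) \<longlonglongrightarrow> f x"
  shows "(\<lambda>n::nat. signed_integral M s (u n)) \<longlonglongrightarrow> signed_integral M s f"
proof -
  have conv: "(\<lambda>n. integral\<^sup>L N (u n)) \<longlonglongrightarrow> integral\<^sup>L N f"
    if "finite_measure N" "sets N = sets M" for N
  proof -
    interpret finite_measure N by fact
    have [simp]: "space N = space M" using that(2) by (rule sets_eq_imp_space_eq)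
    have [measurable_cong]: "sets N = sets M" by fact
    show ?thesis
      using u f K lim
      by (intro integral_dominated_convergence[where w="\<lambda>_. K"] AE_I2) auto
  qed
  show ?thesis
    unfolding signed_integral_def
    using finite_upper_variation[OF s] finite_lower_variation[OF s]
    by (intro tendsto_diff conv) simp_all
qed

section \<open>Transfer to complex measures\<close>

lemma complex_measure_integral_indicator:
  assumes \<mu>: "complex_measure M \<mu>" and E: "E \<in> sets M"
  shows "complex_measure_integral M \<mu> (indicator E) = \<mu> E"
  unfolding complex_measure_integral_def
    signed_integral_indicator[OF signed_measure_Re[OF \<mu>] E]
    signed_integral_indicator[OF signed_measure_Im[OF \<mu>] E]
  by (rule complex_eq[symmetric])

lemma complex_measure_integral_sum:
  fixes f :: "'i \<Rightarrow> 'a \<Rightarrow> complex"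
  assumes \<mu>: "complex_measure M \<mu>" and "\<And>i. i \<in> I \<Longrightarrow> f i \<in> borel_measurable M"
    and "\<And>i x. i \<in> I \<Longrightarrow> x \<in> space M \<Longrightarrow> norm (f i x) \<le> K"
  shows "complex_measure_integral M \<mu> (\<lambda>x. \<Sum>i\<in>I. c i * f i x) =
    (\<Sum>i\<in>I. c i * complex_measure_integral M \<mu> (f i))"
proof -
  have "signed_integral M s (\<lambda>x. \<Sum>i\<in>I. c i * f i x) = (\<Sum>i\<in>I. c i * signed_integral M s (f i))"
    if "signed_measure M s" for s
    using that assms(2,3) by (rule signed_integral_sum)
  then show ?thesis
    using signed_measure_Re[OF \<mu>] signed_measure_Im[OF \<mu>]
    by (simp add: complex_measure_integral_def sum_distrib_left sum.distrib algebra_simps)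
qed

lemma complex_measure_integral_bounded_convergence:
  fixes f :: "'a \<Rightarrow> complex"
  assumes \<mu>: "complex_measure M \<mu>" and "\<And>n. u n \<in> borel_measurable M"
    and "f \<in> borel_measurable M"
    and "\<And>n x. x \<in> space M \<Longrightarrow> norm (u n x) \<le> K"
    and "\<And>x. x \<in> space M \<Longrightarrow> (\<lambda>n. u n x) \<longlonglongrightarrow> f x"
  shows "(\<lambda>n::nat. complex_measure_integral M \<mu> (u n)) \<longlonglongrightarrow> complex_measure_integral M \<mu> f"
proof -
  have "(\<lambda>n. signed_integral M s (u n)) \<longlonglongrightarrow> signed_integral M s f" if "signed_measure M s" for s
    using that assms(2-5) by (rule signed_integral_bounded_convergence)
  then show ?thesis
    unfolding complex_measure_integral_def
    by (intro tendsto_add tendsto_mult tendsto_const) (simp_all add: signed_measure_Re signed_measure_Im \<mu>)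
qed

text \<open>The common engine of the two approximation steps below: polynomials to continuous
  functions, and continuous functions to indicators.\<close>

lemma complex_measure_integral_eq_limit:
  fixes f :: "'a \<Rightarrow> complex"
  assumes \<mu>: "complex_measure M \<mu>" and \<nu>: "complex_measure M \<nu>"
    and u: "\<And>n::nat. u n \<in> borel_measurable M"
    and f: "f \<in> borel_measurable M"
    and K: "\<And>n x. x \<in> space M \<Longrightarrow> norm (u n x) \<le> K"
    and lim: "\<And>x. x \<in> space M \<Longrightarrow> (\<lambda>n. u n x) \<longlonglongrightarrow> f x"
    and eq: "\<And>n. complex_measure_integral M \<mu> (u n) = complex_measure_integral M \<nu> (u n)"
  shows "complex_measure_integral M \<mu> f = complex_measure_integral M \<nu> f"
  using complex_measure_integral_bounded_convergence[OF \<mu> u f K lim]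
    complex_measure_integral_bounded_convergence[OF \<nu> u f K lim]
  unfolding eq by (rule LIMSEQ_unique)

section \<open>Measurability on the half-line\<close>

lemma space_half_line_borel [simp]: "space half_line_borel = {0..}"
  by (simp add: half_line_borel_def)

lemma sets_half_line_borel: "sets half_line_borel = (\<lambda>A. A \<inter> {0..}) ` sets borel"
  unfolding half_line_borel_def sets_restrict_space by (simp add: Int_commute)

lemma borel_measurable_half_line:
  "f \<in> borel_measurable borel \<Longrightarrow> f \<in> borel_measurable half_line_borel"
  unfolding half_line_borel_def by (rule measurable_restrict_space1)

section \<open>From exponentials to indicators of initial segments\<close>

text \<open>Since \<open>exp (- t) ^ i = exp (- (i * t))\<close>, a polynomial in
  \<open>exp (- t)\<close> is a linear combination of the given exponentials, each bounded by 1 on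
  the half-line.\<close>

lemma complex_measure_integral_polynomial_exp:
  fixes \<mu> \<nu> :: "real set \<Rightarrow> complex"
  assumes \<mu>: "complex_measure half_line_borel \<mu>" and \<nu>: "complex_measure half_line_borel \<nu>"
    and eq: "\<And>n::nat.
      complex_measure_integral half_line_borel \<mu> (\<lambda>t. complex_of_real (exp (- (real n * t)))) =
      complex_measure_integral half_line_borel \<nu> (\<lambda>t. complex_of_real (exp (- (real n * t))))"
    and p: "real_polynomial_function p"
  shows "complex_measure_integral half_line_borel \<mu> (\<lambda>t. complex_of_real (p (exp (- t)))) =
    complex_measure_integral half_line_borel \<nu> (\<lambda>t. complex_of_real (p (exp (- t))))"
proof -
  obtain a n where p: "p = (\<lambda>x. \<Sum>i\<le>n. a i * x ^ i)"
    using p by (auto simp: real_polynomial_function_iff_sum)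
  have *: "(\<lambda>t. complex_of_real (p (exp (- t)))) =
      (\<lambda>t. \<Sum>i\<le>n. complex_of_real (a i) * complex_of_real (exp (- (real i * t))))"
    by (simp add: p fun_eq_iff flip: exp_of_nat_mult)
  have "complex_measure_integral half_line_borel \<rho> (\<lambda>t. complex_of_real (p (exp (- t)))) =
      (\<Sum>i\<le>n. complex_of_real (a i) *
        complex_measure_integral half_line_borel \<rho> (\<lambda>t. complex_of_real (exp (- (real i * t)))))"
    if "complex_measure half_line_borel \<rho>" for \<rho>
    unfolding * using that
  proof (rule complex_measure_integral_sum)
    show "(\<lambda>t. complex_of_real (exp (- (real i * t)))) \<in> borel_measurable half_line_borel" for i
      by (intro borel_measurable_half_line) measurable
    show "norm (complex_of_real (exp (- (real i * t)))) \<le> 1" if "t \<in> space half_line_borel" for i t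
      using that by simp
  qed
  then show ?thesis using \<mu> \<nu> by (simp add: eq)
qed

text \<open>For \<open>t \<ge> 0\<close> the value \<open>exp (- t)\<close> stays in the compact
  interval \<open>{0..1}\<close>, so uniform approximation of \<open>g\<close> there
  suffices.\<close>

lemma complex_measure_integral_continuous_exp:
  fixes \<mu> \<nu> :: "real set \<Rightarrow> complex"
  assumes \<mu>: "complex_measure half_line_borel \<mu>" and \<nu>: "complex_measure half_line_borel \<nu>"
    and eq: "\<And>n::nat.
      complex_measure_integral half_line_borel \<mu> (\<lambda>t. complex_of_real (exp (- (real n * t)))) =
      complex_measure_integral half_line_borel \<nu> (\<lambda>t. complex_of_real (exp (- (real n * t))))"
    and g: "continuous_on UNIV g"
  shows "complex_measure_integral half_line_borel \<mu> (\<lambda>t. complex_of_real (g (exp (- t)))) =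
    complex_measure_integral half_line_borel \<nu> (\<lambda>t. complex_of_real (g (exp (- t))))"
proof -
  have "\<exists>p. real_polynomial_function p \<and> (\<forall>x\<in>{0..1}. \<bar>g x - p x\<bar> < inverse (real (Suc n)))" for n
  proof -
    have "continuous_on {0..1} g" using g by (rule continuous_on_subset) simp
    then show ?thesis
      using Stone_Weierstrass_real_polynomial_function[of "{0..1}" g "inverse (real (Suc n))"]
      by (metis compact_Icc inverse_positive_iff_positive of_nat_0_less_iff zero_less_Suc)
  qed
  then obtain p where p: "\<And>n. real_polynomial_function (p n)"
    and close: "\<And>n x. x \<in> {0..1} \<Longrightarrow> \<bar>g x - p n x\<bar> < inverse (real (Suc n))"
    by metis
  have "compact (g ` {0..1})"
    using g by (intro compact_continuous_image) (auto intro: continuous_on_subset)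
  then have "bounded (g ` {0..1})" by (rule compact_imp_bounded)
  then obtain K where K: "\<And>x. x \<in> {0..1} \<Longrightarrow> \<bar>g x\<bar> \<le> K"
    unfolding bounded_iff by (metis imageI real_norm_def)
  have cont: "continuous_on UNIV (p n)" for n
    using p by (intro continuous_on_polymonial_function) (simp add: real_polynomial_function_eq)
  have meas: "(\<lambda>t. complex_of_real (h (exp (- t)))) \<in> borel_measurable half_line_borel"
    if "continuous_on UNIV h" for h :: "real \<Rightarrow> real"
    by (intro borel_measurable_half_line borel_measurable_continuous_onI continuous_intros
        continuous_on_compose2[OF that]) auto
  show ?thesis
  proof (rule complex_measure_integral_eq_limit[OF \<mu> \<nu>, where K="K + 1"
        and u="\<lambda>n t. complex_of_real (p n (exp (- t)))"])
    fix n t assume "t \<in> space half_line_borel"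
    then have t: "exp (- t) \<in> {0..1}" by simp
    \<comment> \<open>All errors are at most 1, hence the uniform bound \<open>K + 1\<close>, where
      \<open>K\<close> bounds \<open>g\<close> on \<open>{0..1}\<close>.\<close>
    have "inverse (real (Suc n)) \<le> 1" by (simp add: field_simps)
    then show "norm (complex_of_real (p n (exp (- t)))) \<le> K + 1"
      using close[OF t, of n] K[OF t] by (simp only: norm_of_real)
  next
    fix t assume "t \<in> space half_line_borel"
    then have t: "exp (- t) \<in> {0..1}" by simp
    have "(\<lambda>n. p n (exp (- t)) - g (exp (- t))) \<longlonglongrightarrow> 0"
    proof (rule Lim_null_comparison[OF _ LIMSEQ_inverse_real_of_nat])
      show "\<forall>\<^sub>F n in sequentially. norm (p n (exp (- t)) - g (exp (- t))) \<le> inverse (real (Suc n))"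
        using close[OF t] by (intro always_eventually allI) (simp only: real_norm_def abs_minus_commute less_imp_le)
    qed
    then show "(\<lambda>n. complex_of_real (p n (exp (- t)))) \<longlonglongrightarrow> complex_of_real (g (exp (- t)))"
      by (intro tendsto_of_real) (rule LIM_zero_cancel)
  qed (use meas g cont complex_measure_integral_polynomial_exp[OF \<mu> \<nu> eq p] in auto)
qed

lemma complex_measure_eq_initial_segment:
  fixes \<mu> \<nu> :: "real set \<Rightarrow> complex"
  assumes \<mu>: "complex_measure half_line_borel \<mu>" and \<nu>: "complex_measure half_line_borel \<nu>"
    and eq: "\<And>n::nat.
      complex_measure_integral half_line_borel \<mu> (\<lambda>t. complex_of_real (exp (- (real n * t)))) =
      complex_measure_integral half_line_borel \<nu> (\<lambda>t. complex_of_real (exp (- (real n * t))))"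
  shows "\<mu> ({..<x} \<inter> {0..}) = \<nu> ({..<x} \<inter> {0..})"
proof -
  \<comment> \<open>A continuous ramp: it vanishes for \<open>u \<le> exp (- x)\<close> and, as
    \<open>k\<close> grows, tends to 1 for \<open>u > exp (- x)\<close>. With
    \<open>u = exp (- t)\<close> the latter means \<open>t < x\<close>; at \<open>t = x\<close> the
    ramp is 0, which is why the segments exclude their right endpoint.\<close>
  define h where "h k u = min 1 (real k * max 0 (u - exp (- x)))" for k u
  have cont: "continuous_on UNIV (h k)" for k
    unfolding h_def by (intro continuous_intros)
  have E: "{..<x} \<inter> {0..} \<in> sets half_line_borel" by (auto simp: sets_half_line_borel)
  have "complex_measure_integral half_line_borel \<mu> (indicator ({..<x} \<inter> {0..})) =
      complex_measure_integral half_line_borel \<nu> (indicator ({..<x} \<inter> {0..}))"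
  proof (rule complex_measure_integral_eq_limit[OF \<mu> \<nu>, where K=1
        and u="\<lambda>k t. complex_of_real (h k (exp (- t)))"])
    show "(\<lambda>t. complex_of_real (h k (exp (- t)))) \<in> borel_measurable half_line_borel" for k
      by (intro borel_measurable_half_line borel_measurable_continuous_onI continuous_intros
          continuous_on_compose2[OF cont]) auto
    show "norm (complex_of_real (h k (exp (- t)))) \<le> 1" for k t
      by (simp add: h_def)
    fix t :: real assume "t \<in> space half_line_borel"
    then have t: "0 \<le> t" by simp
    show "(\<lambda>k. complex_of_real (h k (exp (- t)))) \<longlonglongrightarrow> indicator ({..<x} \<inter> {0..}) t"
    proof (cases "t < x")
      case True
      then have d: "0 < exp (- t) - exp (- x)" by simp
      \<comment> \<open>From this slope on, the ramp has reached its cap at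
        \<open>exp (- t)\<close>, so the sequence is eventually constant 1.\<close>
      then obtain N :: nat where "inverse (exp (- t) - exp (- x)) < real N"
        using reals_Archimedean2 by blast
      then have N: "1 < real N * (exp (- t) - exp (- x))" using d by (simp add: field_simps)
      have "h k (exp (- t)) = 1" if "N \<le> k" for k
      proof -
        have "real N * (exp (- t) - exp (- x)) \<le> real k * (exp (- t) - exp (- x))"
          using that d by (intro mult_right_mono) auto
        then show ?thesis using N d unfolding h_def by linarith
      qed
      then show ?thesis using True t
        by (intro tendsto_eventually eventually_sequentiallyI[of N]) auto
    qed (simp add: h_def)
  qed (use E complex_measure_integral_continuous_exp[OF \<mu> \<nu> eq cont] in auto)
  then show ?thesis by (simp only: complex_measure_integral_indicator[OF \<mu> E]
        complex_measure_integral_indicator[OF \<nu> E])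
qed

section \<open>Dynkin system argument\<close>

theorem theorem2p1:
  fixes \<mu> \<nu> :: "real set \<Rightarrow> complex"
  assumes "complex_measure half_line_borel \<mu>"
    and "complex_measure half_line_borel \<nu>"
    and "\<And>n::nat.
      complex_measure_integral half_line_borel \<mu> (\<lambda>t. complex_of_real (exp (- (real n * t)))) =
      complex_measure_integral half_line_borel \<nu> (\<lambda>t. complex_of_real (exp (- (real n * t))))"
  shows "\<forall>E \<in> sets half_line_borel. \<mu> E = \<nu> E"
proof -
  note \<mu> = assms(1) and \<nu> = assms(2)
  have half_line: "{0..} \<in> sets half_line_borel"
    using sets.top[of half_line_borel] by simp
  have total: "\<mu> {0..} = \<nu> {0..}"
  proof -
    \<comment> \<open>For exponent 0 the integrand is the constant 1. It agrees with the indicator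
      only on the half-line, which is the space of both variations, so the integrals are compared by
      congruence.\<close>
    have eq: "complex_measure_integral half_line_borel \<rho> (\<lambda>t. complex_of_real (exp (- (real 0 * t)))) =
        complex_measure_integral half_line_borel \<rho> (indicator {0..})" for \<rho>
      unfolding complex_measure_integral_def signed_integral_def
      by (intro arg_cong2[where f="(+)"] arg_cong2[where f="(-)"] arg_cong2[where f="(*)"] refl
          Bochner_Integration.integral_cong) auto
    show ?thesis
      using assms(3)[of 0] unfolding eq
      by (simp only: complex_measure_integral_indicator[OF \<mu> half_line]
          complex_measure_integral_indicator[OF \<nu> half_line])
  qed
  \<comment> \<open>The induction runs over Borel sets of the whole line, generated by the rays
    \<open>{..<x}\<close>, and compares the measures on their traces; these traces are exactly the
    measurable sets of \<open>half_line_borel\<close>.\<close>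
  have "\<mu> (A \<inter> {0..}) = \<nu> (A \<inter> {0..})" if "A \<in> sets borel" for A :: "real set"
  proof -
    have Int: "Int_stable (range lessThan :: real set set)"
    proof (rule Int_stableI_image)
      show "\<exists>z\<in>UNIV. {..<x} \<inter> {..<y} = {..<z}" for x y :: real
        by (intro bexI[of _ "min x y"]) auto
    qed
    have subset_Pow: "range lessThan \<subseteq> Pow (UNIV :: real set)" by simp
    have borel: "sets borel = sigma_sets UNIV (range lessThan :: real set set)"
      by (subst borel_Iio) simp
    show ?thesis
      using that unfolding borel
    proof (induction rule: sigma_sets_induct_disjoint[OF Int subset_Pow, consumes 1, case_names basic empty compl union])
      case (basic A)
      then show ?case using complex_measure_eq_initial_segment[OF assms] by auto
    next
      case empty
      then show ?case using \<mu> \<nu> by (simp add: complex_measure_def)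
    next
      case (compl A)
      then have A: "A \<inter> {0..} \<in> sets half_line_borel"
        unfolding borel[symmetric] by (auto simp: sets_half_line_borel)
      \<comment> \<open>A complement in the line becomes a relative complement in
        \<open>{0..}\<close>, where \<open>total\<close> supplies the value to subtract
        from.\<close>
      have "(UNIV - A) \<inter> {0..} = {0..} - A \<inter> {0..}" by auto
      then show ?case
        using compl A half_line total by (simp add: complex_measure_Diff[OF \<mu>] complex_measure_Diff[OF \<nu>])
    next
      case (union A)
      have range: "range (\<lambda>n. A n \<inter> {0..}) \<subseteq> sets half_line_borel"
        using union unfolding borel[symmetric] by (auto simp: sets_half_line_borel)
      have "disjoint_family (\<lambda>n. A n \<inter> {0..})"
        using union(1) by (auto simp: disjoint_family_on_def)
      \<comment> \<open>By the induction hypothesis the two series have the same terms, so their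
        sums coincide.\<close>
      note sums = complex_measure_sums[OF \<mu> range this] complex_measure_sums[OF \<nu> range this]
      show ?case using sums unfolding union(3) UN_extend_simps by (simp add: sums_unique2)
    qed
  qed
  then show ?thesis by (auto simp: sets_half_line_borel)
qed

end
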